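(* Consider the closed-loop linear time-invariant system $\dot x=A_{cl}x+B_{cl}w$, $z=C_{cl}x+D_{cl}w$ with real matrices, $x\in\mathbb{R}^n$, and let $\gamma_{new}\in\mathbb{R}$. The system is stable and its $L_2$ gain (from $w$ to $z$) is less than $\gamma_{new}$ if there exist a constant $0<\epsilon_1<1$ and square matrices $X_1>0$ and $G_1$ (both $n\times n$) which satisfy $$\left(\begin{array}{cccc} X_1 & B_{cl} & 0 & -X_1\\ \star & -\gamma_{new} I & D_{cl}^T & 0\\ \star & \star & -\gamma_{new} I & 0\\ \star & \star & \star & 0\end{array}\right)+\mathbf{He}(\mathcal{Q}^TG_1\mathcal{P})<0,$$ where $\mathcal{P}=[\,I\quad 0\quad 0\quad -2\epsilon_1 I\,]$ and $\mathcal{Q}=[\,(A_{cl}^T-\tfrac12 I)\quad 0\quad C_{cl}^T\quad I\,]$.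
   Context: $\mathbf{He}(A)=A+A^T$. The symbol $\star$ denotes entries determined by symmetry of the matrix. For symmetric matrices, $M>0$ ($M<0$) means positive (negative) definite; $X_1>0$ means $X_1$ is symmetric positive definite, while $G_1$ need not be symmetric. The matrices $\mathcal{P}$, $\mathcal{Q}$ are partitioned conformally with the $4\times4$ block matrix (block sizes $n$, $\dim w$, $\dim z$, $n$). "Stable" means $A_{cl}$ is Hurwitz. The $L_2$ gain is $\|T_{zw}\|_\infty=\sup_{\omega\in\mathbb{R}}\bar\sigma(T_{zw}(j\omega))$ with $T_{zw}(s)=C_{cl}(sI-A_{cl})^{-1}B_{cl}+D_{cl}$, where $\bar\sigma$ is the largest singular value. *)

theory Defs
  imports "HOL-Analysis.Analysis"
begin

section \<open>Definite matrices and block matrices\<close>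

definition pos_def_matrix :: "real^'n^'n \<Rightarrow> bool" where
  "pos_def_matrix M \<longleftrightarrow> transpose M = M \<and> (\<forall>x. x \<noteq> 0 \<longrightarrow> 0 < x \<bullet> (M *v x))"

definition neg_def_matrix :: "real^'n^'n \<Rightarrow> bool" where
  "neg_def_matrix M \<longleftrightarrow> transpose M = M \<and> (\<forall>x. x \<noteq> 0 \<longrightarrow> x \<bullet> (M *v x) < 0)"

definition He :: "real^'n^'n \<Rightarrow> real^'n^'n" where
  "He M = M + transpose M"

text \<open>A partition of the index set of a matrix is given by a sum type.\<close>

definition beside :: "'a^'m^'r \<Rightarrow> 'a^'n^'r \<Rightarrow> 'a^('m::finite + 'n::finite)^'r"  (infixr \<open>|||\<close> 60) where
  "M ||| N = (\<chi> i j. case j of Inl k \<Rightarrow> M $ i $ k | Inr k \<Rightarrow> N $ i $ k)"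

definition above :: "'a^'c^'m \<Rightarrow> 'a^'c^'n \<Rightarrow> 'a^'c^('m::finite + 'n::finite)"  (infixr \<open>'/'/'/\<close> 55) where
  "M /// N = (\<chi> i. case i of Inl k \<Rightarrow> M $ k | Inr k \<Rightarrow> N $ k)"

section \<open>The linear matrix inequality\<close>

definition lmi_base ::
    "real \<Rightarrow> real^'w^'n \<Rightarrow> real^'w^'z \<Rightarrow> real^'n^'n
      \<Rightarrow> real^('n + 'w + 'z + 'n)^('n + 'w + 'z + 'n)" where
  "lmi_base \<gamma> B D X =
     (X             ||| B                ||| 0                ||| - X) ///
     (transpose B   ||| - (\<gamma> *\<^sub>R mat 1) ||| transpose D      ||| 0) ///
     (0             ||| D                ||| - (\<gamma> *\<^sub>R mat 1) ||| 0) ///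
     (- transpose X ||| 0                ||| 0                ||| 0)"

definition lmi_P :: "real \<Rightarrow> real^('n + 'w::finite + 'z::finite + 'n)^'n" where
  "lmi_P \<epsilon> = mat 1 ||| 0 ||| 0 ||| - ((2 * \<epsilon>) *\<^sub>R mat 1)"

definition lmi_Q :: "real^'n^'n \<Rightarrow> real^'n^'z \<Rightarrow> real^('n + 'w::finite + 'z + 'n)^'n" where
  "lmi_Q A C = (transpose A - (1/2) *\<^sub>R mat 1) ||| 0 ||| transpose C ||| mat 1"

section \<open>Stability and gain\<close>

definition cmat :: "real^'m^'n \<Rightarrow> complex^'m^'n" where
  "cmat = map_matrix complex_of_real"

definition conj_transpose :: "complex^'m^'n \<Rightarrow> complex^'n^'m" where
  "conj_transpose M = map_matrix cnj (transpose M)"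

definition eigenvalues :: "complex^'n^'n \<Rightarrow> complex set" where
  "eigenvalues M = {l. \<exists>v. v \<noteq> 0 \<and> M *v v = l *s v}"

definition hurwitz :: "real^'n^'n \<Rightarrow> bool" where
  "hurwitz A \<longleftrightarrow> (\<forall>l \<in> eigenvalues (cmat A). Re l < 0)"

definition singular_values :: "complex^'m^'n \<Rightarrow> real set" where
  "singular_values M =
     {s. 0 \<le> s \<and> complex_of_real (s\<^sup>2) \<in> eigenvalues (conj_transpose M ** M)}"

definition max_singular_value :: "complex^'m^'n \<Rightarrow> real" where
  "max_singular_value M = Max (singular_values M)"

definition transfer_function ::
    "real^'n^'n \<Rightarrow> real^'w^'n \<Rightarrow> real^'n^'z \<Rightarrow> real^'w^'z \<Rightarrow> complex \<Rightarrow> complex^'w^'z" where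
  "transfer_function A B C D s =
     cmat C ** matrix_inv (mat s - cmat A) ** cmat B + cmat D"

text \<open>The supremum is taken in the extended reals, so that an unbounded frequency
  response has gain \<open>\<infinity>\<close> rather than an unspecified real value. At a pole on the imaginary
  axis \<open>matrix_inv\<close> is unspecified; this cannot occur when \<open>A\<close> is Hurwitz.\<close>

definition L2_gain ::
    "real^'n^'n \<Rightarrow> real^'w^'n \<Rightarrow> real^'n^'z \<Rightarrow> real^'w^'z \<Rightarrow> ereal" where
  "L2_gain A B C D =
     (SUP \<omega>::real. ereal (max_singular_value (transfer_function A B C D (\<i> * complex_of_real \<omega>))))"

end

theory Submission
  imports Defs
begin

text \<open>
  The multiplier \<open>G\<close> disappears from the matrix inequality on the kernel of \<open>\<Q>\<close>. Since the last
  block of \<open>\<Q>\<close> is the identity, that kernel is a graph: for given \<open>x, w, z\<close> it contains the vector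
  with last component \<open>y = x/2 - A\<^sup>Tx - C\<^sup>Tz\<close>, and on such vectors the quadratic form of the LMI equals
  \<open>2 x\<^sup>TX(A\<^sup>Tx + C\<^sup>Tz) + 2 x\<^sup>TBw + 2 z\<^sup>TDw - \<gamma>|w|\<^sup>2 - \<gamma>|z|\<^sup>2\<close>.
  The constant \<open>1/2\<close> in \<open>\<Q>\<close> is what cancels the block \<open>X\<close> in the corner. Negativity of this form is
  the bounded real inequality for the dual system \<open>(A\<^sup>T, C\<^sup>T, B\<^sup>T, D\<^sup>T)\<close>, and compactness of the unit
  sphere strengthens it to an upper bound \<open>- \<delta> (|x|\<^sup>2 + |w|\<^sup>2 + |z|\<^sup>2)\<close> with \<open>\<delta> > 0\<close>
  (\<open>lmi_dual_bounded_real\<close>). Adding it for the real and imaginary parts gives the same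
  inequality for complex vectors.

  Stability: an eigenvalue \<open>l\<close> of \<open>A\<close> is one of \<open>A\<^sup>T\<close>; with \<open>A\<^sup>Tx = l x\<close> and \<open>w = z = 0\<close> the
  inequality reads \<open>2 Re l \<cdot> x\<^sup>*Xx < 0\<close>, so \<open>Re l < 0\<close>.

  Gain: for \<open>s = i \<omega>\<close> and a given \<open>z\<close> let \<open>x\<close> be the response of the dual system,
  \<open>x = (sI - A)\<^sup>-\<^sup>*C\<^sup>Tz\<close>. Then \<open>A\<^sup>Tx + C\<^sup>Tz\<close> is the imaginary multiple \<open>- i \<omega> x\<close> of \<open>x\<close>, so the term with
  \<open>X\<close> vanishes, and the two terms with \<open>B\<close> and \<open>D\<close> combine to \<open>2 Re z\<^sup>*T(i\<omega>)w\<close>. What is left,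
  \<open>2 Re z\<^sup>*T(i\<omega>)w \<le> (\<gamma> - \<delta>)(|w|\<^sup>2 + |z|\<^sup>2)\<close>, bounds every singular value by \<open>\<gamma> - \<delta>\<close>
  (\<open>max_singular_value_le\<close>). As \<open>\<delta>\<close> is independent of the frequency, the supremum is below \<open>\<gamma>\<close>.
  For the maximum over the singular values to be meaningful, their set must be shown to be finite
  and nonempty, which is done by the spectral theory of the self-adjoint matrix \<open>T\<^sup>*T\<close>.
\<close>

section \<open>Block vectors and quadratic forms\<close>

definition vstack :: "'a^'m \<Rightarrow> 'a^'n \<Rightarrow> 'a^('m::finite + 'n::finite)" where
  "vstack x y = (\<chi> i. case i of Inl k \<Rightarrow> x $ k | Inr k \<Rightarrow> y $ k)"

lemma sum_UNIV_sum:
  fixes f :: "'m::finite + 'n::finite \<Rightarrow> 'a::comm_monoid_add"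
  shows "sum f UNIV = (\<Sum>i\<in>UNIV. f (Inl i)) + (\<Sum>i\<in>UNIV. f (Inr i))"
  unfolding UNIV_Plus_UNIV[symmetric] by (subst sum.Plus) simp_all

lemma beside_vstack: "(M ||| N) *v vstack x y = M *v x + N *v y"
  by (simp add: vec_eq_iff matrix_vector_mult_def beside_def vstack_def sum_UNIV_sum)

lemma above_mult: "(M /// N) *v v = vstack (M *v v) (N *v v)"
  by (auto simp add: vec_eq_iff matrix_vector_mult_def above_def vstack_def split: sum.split)

lemma inner_vstack: "vstack x y \<bullet> vstack x' y' = x \<bullet> x' + y \<bullet> y'"
  by (simp add: inner_vec_def vstack_def sum_UNIV_sum)

lemma inner_transpose_mult: "x \<bullet> (transpose (M::real^'m^'n) *v y) = y \<bullet> (M *v x)"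
  by (metis dot_lmul_matrix inner_commute transpose_matrix_vector)

lemma inner_He: "v \<bullet> (He M *v v) = 2 * (v \<bullet> (M *v v))"
  unfolding He_def matrix_vector_mult_add_rdistrib inner_add_right inner_transpose_mult
  by (rule mult_2[symmetric])

text \<open>A homogeneous quadratic form is bounded by its maximum over the compact unit sphere, and
  this maximum is attained, hence negative.\<close>

lemma neg_def_uniform:
  assumes "neg_def_matrix M"
  obtains \<delta> where "\<delta> > 0" "\<And>v. v \<bullet> (M *v v) \<le> - \<delta> * (v \<bullet> v)"
proof -
  have "compact (sphere (0::real^'a) 1)" by simp
  moreover have "sphere (0::real^'a) 1 \<noteq> {}" by simp
  moreover have "continuous_on (sphere 0 1) (\<lambda>v. v \<bullet> (M *v v))"
    by (intro continuous_intros)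
  ultimately obtain u where u: "u \<in> sphere 0 1"
    and max: "\<And>v. v \<in> sphere 0 1 \<Longrightarrow> v \<bullet> (M *v v) \<le> u \<bullet> (M *v u)"
    using continuous_attains_sup[of "sphere 0 1" "\<lambda>v. v \<bullet> (M *v v)"] by blast
  have "u \<noteq> 0" using u by auto
  then have neg: "u \<bullet> (M *v u) < 0"
    using assms by (simp add: neg_def_matrix_def)
  have "v \<bullet> (M *v v) \<le> u \<bullet> (M *v u) * (v \<bullet> v)" for v
  proof (cases "v = 0")
    case False
    have "v = norm v *\<^sub>R sgn v"
      using False by (simp add: sgn_div_norm)
    then have "v \<bullet> (M *v v) = (norm v *\<^sub>R sgn v) \<bullet> (M *v (norm v *\<^sub>R sgn v))"
      by (rule arg_cong[where f = "\<lambda>u. u \<bullet> (M *v u)"])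
    also have "\<dots> = (norm v)\<^sup>2 * (sgn v \<bullet> (M *v sgn v))"
      unfolding matrix_vector_mult_scaleR inner_scaleR_left inner_scaleR_right
      by (simp only: power2_eq_square mult.assoc)
    also have "\<dots> \<le> (norm v)\<^sup>2 * (u \<bullet> (M *v u))"
      using max[of "sgn v"] False by (intro mult_left_mono) (auto simp: norm_sgn)
    finally show ?thesis by (simp add: power2_norm_eq_inner mult.commute)
  qed simp
  with neg show ?thesis by (intro that[of "- (u \<bullet> (M *v u))"]) auto
qed

section \<open>The dual bounded real inequality\<close>

lemma inner_lmi_base:
  fixes B :: "real^'w^'n" and D :: "real^'w^'z"
  assumes "transpose X = X"
  shows "vstack x (vstack w (vstack z y)) \<bullet> (lmi_base \<gamma> B D X *v vstack x (vstack w (vstack z y)))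
    = x \<bullet> (X *v x) - 2 * (x \<bullet> (X *v y)) + 2 * (x \<bullet> (B *v w)) + 2 * (z \<bullet> (D *v w))
      - \<gamma> * (w \<bullet> w) - \<gamma> * (z \<bullet> z)"
proof -
  have neg: "(- M) *v u = - (M *v u)" for M :: "real^'c^'d" and u
    by (simp add: vec_eq_iff matrix_vector_mult_def sum_negf)
  have "y \<bullet> (X *v x) = x \<bullet> (X *v y)"
    using inner_transpose_mult[of y X x] assms by simp
  moreover note inner_transpose_mult[of w B x] inner_transpose_mult[of w D z]
  ultimately show ?thesis
    by (simp add: lmi_base_def above_mult beside_vstack inner_vstack neg assms inner_add_right
        inner_diff_right scaleR_matrix_vector_assoc[symmetric] del: transpose_matrix_vector)
qed

text \<open>On the kernel of \<open>\<Q>\<close> the term with \<open>G\<close> vanishes, and dropping the contribution of the last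
  component to \<open>|v|\<^sup>2\<close> only weakens the uniform bound.\<close>

lemma lmi_dual_bounded_real:
  fixes A :: "real^'n^'n" and B :: "real^'w^'n" and C :: "real^'n^'z" and D :: "real^'w^'z"
  assumes "transpose X = X"
    and "neg_def_matrix (lmi_base \<gamma> B D X + He (transpose (lmi_Q A C) ** G ** lmi_P \<epsilon>))"
  obtains \<delta> where "\<delta> > 0"
    "\<And>x w z. 2 * (x \<bullet> (X *v (transpose A *v x + transpose C *v z))) + 2 * (x \<bullet> (B *v w))
        + 2 * (z \<bullet> (D *v w)) - \<gamma> * (w \<bullet> w) - \<gamma> * (z \<bullet> z)
      \<le> - \<delta> * (x \<bullet> x + w \<bullet> w + z \<bullet> z)"
proof -
  let ?K = "transpose (lmi_Q A C) ** G ** (lmi_P \<epsilon> :: real^('n + 'w + 'z + 'n)^'n)"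
  obtain \<delta> where \<delta>: "\<delta> > 0"
    and le: "\<And>v. v \<bullet> ((lmi_base \<gamma> B D X + He ?K) *v v) \<le> - \<delta> * (v \<bullet> v)"
    using neg_def_uniform[OF assms(2)] by blast
  show ?thesis
  proof (rule that[OF \<delta>])
    fix x :: "real^'n" and w :: "real^'w" and z :: "real^'z"
    define p where "p = transpose A *v x + transpose C *v z"
    \<comment> \<open>The solution of \<open>\<Q>v = 0\<close> for the last block component.\<close>
    define y where "y = (1/2) *\<^sub>R x - p"
    define v where "v = vstack x (vstack w (vstack z y))"
    have "lmi_Q A C *v v = 0"
      by (simp add: lmi_Q_def v_def beside_vstack y_def p_def matrix_vector_mult_diff_rdistrib
          scaleR_matrix_vector_assoc[symmetric])
    then have "v \<bullet> (?K *v v) = 0"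
      by (simp add: matrix_vector_mul_assoc[symmetric] inner_transpose_mult
          del: transpose_matrix_vector)
    moreover have "v \<bullet> (lmi_base \<gamma> B D X *v v)
        = x \<bullet> (X *v x) - 2 * (x \<bullet> (X *v y)) + 2 * (x \<bullet> (B *v w)) + 2 * (z \<bullet> (D *v w))
          - \<gamma> * (w \<bullet> w) - \<gamma> * (z \<bullet> z)"
      unfolding v_def by (rule inner_lmi_base[OF assms(1)])
    moreover have "\<dots> = 2 * (x \<bullet> (X *v p)) + 2 * (x \<bullet> (B *v w)) + 2 * (z \<bullet> (D *v w))
          - \<gamma> * (w \<bullet> w) - \<gamma> * (z \<bullet> z)"
      by (simp add: y_def matrix_vector_mult_diff_distrib inner_diff_right matrix_vector_mult_scaleR)
    moreover have "- \<delta> * (v \<bullet> v) \<le> - \<delta> * (x \<bullet> x + w \<bullet> w + z \<bullet> z)"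
      using \<delta> by (simp add: v_def inner_vstack)
    ultimately show "2 * (x \<bullet> (X *v (transpose A *v x + transpose C *v z))) + 2 * (x \<bullet> (B *v w))
        + 2 * (z \<bullet> (D *v w)) - \<gamma> * (w \<bullet> w) - \<gamma> * (z \<bullet> z)
      \<le> - \<delta> * (x \<bullet> x + w \<bullet> w + z \<bullet> z)"
      using le[of v] by (simp add: matrix_vector_mult_add_rdistrib inner_add_right inner_He p_def)
  qed
qed

section \<open>Complex vectors as pairs of real vectors\<close>

text \<open>On \<open>complex^'n\<close> the operation \<open>\<bullet>\<close> is the real part of the Hermitian inner product. A real matrix
  acts separately on real and imaginary parts, so every inequality between real quadratic forms
  extends to complex vectors by adding its instances for these two parts.\<close>

definition Re_vec :: "complex^'n \<Rightarrow> real^'n" where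
  "Re_vec v = (\<chi> i. Re (v $ i))"

definition Im_vec :: "complex^'n \<Rightarrow> real^'n" where
  "Im_vec v = (\<chi> i. Im (v $ i))"

lemma inner_Re_Im: "x \<bullet> y = Re_vec x \<bullet> Re_vec y + Im_vec x \<bullet> Im_vec y"
  by (simp add: inner_vec_def Re_vec_def Im_vec_def inner_complex_def sum.distrib)

lemma Re_vec_cmat: "Re_vec (cmat M *v x) = M *v Re_vec x"
  by (simp add: vec_eq_iff Re_vec_def matrix_vector_mult_def cmat_def map_matrix_def)

lemma Im_vec_cmat: "Im_vec (cmat M *v x) = M *v Im_vec x"
  by (simp add: vec_eq_iff Im_vec_def matrix_vector_mult_def cmat_def map_matrix_def)

lemma Re_vec_add: "Re_vec (x + y) = Re_vec x + Re_vec y"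
  by (simp add: vec_eq_iff Re_vec_def)

lemma Im_vec_add: "Im_vec (x + y) = Im_vec x + Im_vec y"
  by (simp add: vec_eq_iff Im_vec_def)

text \<open>For symmetric \<open>X\<close> the number \<open>x\<^sup>*Xx\<close> is real, so \<open>Re (l x\<^sup>*Xx)\<close> involves \<open>Re l\<close> only. With an eigenvalue
  \<open>l\<close> this yields stability; with imaginary \<open>l\<close> it removes \<open>X\<close> from the frequency domain inequality.\<close>

lemma inner_cmat_scale:
  assumes "transpose X = X"
  shows "x \<bullet> (cmat X *v (l *s x)) = Re l * (x \<bullet> (cmat X *v x))"
proof -
  have "Re_vec (l *s x) = Re l *\<^sub>R Re_vec x - Im l *\<^sub>R Im_vec x"
    and "Im_vec (l *s x) = Re l *\<^sub>R Im_vec x + Im l *\<^sub>R Re_vec x"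
    by (simp_all add: vec_eq_iff Re_vec_def Im_vec_def)
  note parts = this
  have "Re_vec x \<bullet> (X *v Im_vec x) = Im_vec x \<bullet> (X *v Re_vec x)"
    using inner_transpose_mult[of "Re_vec x" X "Im_vec x"] assms by simp
  then show ?thesis
    by (simp add: inner_Re_Im Re_vec_cmat Im_vec_cmat parts matrix_vector_mult_diff_distrib
        matrix_vector_right_distrib matrix_vector_mult_scaleR inner_diff_right inner_add_right
        distrib_left)
qed

lemma inner_cmat_pos:
  assumes "pos_def_matrix X" "x \<noteq> 0"
  shows "0 < x \<bullet> (cmat X *v x)"
proof -
  have ge: "0 \<le> a \<bullet> (X *v a)" for a
    using assms(1) by (cases "a = 0") (auto simp: pos_def_matrix_def less_imp_le)
  have "Re_vec x \<noteq> 0 \<or> Im_vec x \<noteq> 0"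
    using assms(2) by (auto simp: vec_eq_iff Re_vec_def Im_vec_def complex_eq_iff)
  then show ?thesis
    using assms(1) ge[of "Re_vec x"] ge[of "Im_vec x"]
    by (auto simp: pos_def_matrix_def inner_Re_Im Re_vec_cmat Im_vec_cmat add_pos_nonneg add_nonneg_pos)
qed

section \<open>Adjoints and eigenvalues\<close>

lemma inner_conj_transpose:
  "(conj_transpose M *v x) \<bullet> y = x \<bullet> (M *v y)"
proof -
  have "(conj_transpose M *v x) \<bullet> y = (\<Sum>j\<in>UNIV. \<Sum>i\<in>UNIV. (cnj (M $ i $ j) * x $ i) \<bullet> (y $ j))"
    by (simp add: inner_vec_def matrix_vector_mult_def conj_transpose_def map_matrix_def transpose_def inner_sum_left)
  also have "\<dots> = (\<Sum>i\<in>UNIV. \<Sum>j\<in>UNIV. (cnj (M $ i $ j) * x $ i) \<bullet> (y $ j))"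
    by (rule sum.swap)
  also have "\<dots> = x \<bullet> (M *v y)"
    by (simp add: inner_vec_def matrix_vector_mult_def inner_sum_right)
       (simp add: inner_complex_def algebra_simps)
  finally show ?thesis .
qed

lemma conj_transpose_mult: "conj_transpose (M ** N) = conj_transpose N ** conj_transpose M"
  by (simp add: vec_eq_iff conj_transpose_def map_matrix_def transpose_def matrix_matrix_mult_def mult.commute)

lemma conj_transpose_cmat: "conj_transpose (cmat M) = cmat (transpose M)"
  by (simp add: vec_eq_iff conj_transpose_def cmat_def map_matrix_def transpose_def)

lemma conj_transpose_char_matrix: "conj_transpose (mat s - cmat A) = mat (cnj s) - cmat (transpose A)"
  by (simp add: vec_eq_iff conj_transpose_def cmat_def map_matrix_def transpose_def mat_def)

lemma mat_mult_vec: "mat (l::'a::comm_semiring_1) *v v = l *s v"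
  by (simp add: vec_eq_iff matrix_vector_mult_def mat_def if_distrib[where f = "\<lambda>a. a * _"] cong: if_cong)

lemma invertible_iff_not_eigenvalue:
  fixes M :: "complex^'n^'n"
  shows "invertible (mat l - M) \<longleftrightarrow> l \<notin> eigenvalues M"
proof -
  have "invertible (mat l - M) \<longleftrightarrow> (\<forall>v. (mat l - M) *v v = 0 \<longrightarrow> v = 0)"
    by (simp only: invertible_left_inverse matrix_left_invertible_ker)
  then show ?thesis
    by (auto simp: eigenvalues_def matrix_vector_mult_diff_rdistrib mat_mult_vec)
qed

text \<open>The dual inequality contains \<open>A\<^sup>T\<close>, while stability is defined by the spectrum of \<open>A\<close>.\<close>

lemma eigenvalues_transpose: "eigenvalues (transpose M) = eigenvalues M"
proof -
  have "transpose (mat l - M) = mat l - transpose M" for l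
    by (simp add: vec_eq_iff transpose_def mat_def)
  then have "det (mat l - transpose M) = det (mat l - M)" for l
    using det_transpose[of "mat l - M"] by simp
  then have "l \<in> eigenvalues (transpose M) \<longleftrightarrow> l \<in> eigenvalues M" for l
    using invertible_iff_not_eigenvalue[of l M] invertible_iff_not_eigenvalue[of l "transpose M"]
    by (simp add: invertible_det_nz)
  then show ?thesis by blast
qed

section \<open>Singular values\<close>

lemma scale_of_real: "complex_of_real c *s x = c *\<^sub>R x"
  by (simp add: vec_eq_iff) (simp add: scaleR_conv_of_real)

lemma self_adjoint_eigenvectors_orthogonal:
  fixes M :: "complex^'n^'n"
  assumes "\<And>x y. x \<bullet> (M *v y) = (M *v x) \<bullet> y"
    and "M *v u = complex_of_real a *s u" "M *v v = complex_of_real b *s v" "a \<noteq> b"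
  shows "u \<bullet> v = 0"
proof -
  have "b * (u \<bullet> v) = a * (u \<bullet> v)"
    using assms(1)[of u v] assms(2,3) by (simp add: scale_of_real del: of_real_power)
  then show ?thesis using assms(4) by simp
qed

text \<open>Distinct singular values have orthogonal, hence distinct, right singular vectors, and a
  finite-dimensional space contains only finitely many pairwise orthogonal vectors.\<close>

lemma finite_singular_values: "finite (singular_values M)"
proof -
  let ?H = "conj_transpose M ** M"
  have sa: "x \<bullet> (?H *v y) = (?H *v x) \<bullet> y" for x y
    by (metis inner_conj_transpose inner_commute matrix_vector_mul_assoc)
  obtain f where f: "\<And>s. s \<in> singular_values M \<Longrightarrow>
      f s \<noteq> 0 \<and> ?H *v f s = complex_of_real (s\<^sup>2) *s f s"
    using bchoice[of "singular_values M" "\<lambda>s v. v \<noteq> 0 \<and> ?H *v v = complex_of_real (s\<^sup>2) *s v"]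
    unfolding singular_values_def eigenvalues_def by blast
  have orth: "f s \<bullet> f t = 0"
    if "s \<in> singular_values M" "t \<in> singular_values M" "s \<noteq> t" for s t
  proof (rule self_adjoint_eigenvectors_orthogonal[OF sa])
    show "s\<^sup>2 \<noteq> t\<^sup>2" using that by (auto simp: singular_values_def)
  qed (use f that in auto)
  have "finite (f ` singular_values M)"
    by (rule pairwise_orthogonal_imp_finite) (auto simp: pairwise_def orthogonal_def intro!: orth)
  moreover have "inj_on f (singular_values M)"
    by (rule inj_onI) (metis f orth inner_eq_zero_iff)
  ultimately show ?thesis by (rule finite_imageD)
qed

text \<open>The operator norm \<open>s\<close> is a singular value: if it is attained at the unit vector \<open>u\<close>, then the
  positive semidefinite form \<open>s\<^sup>2|v|\<^sup>2 - |Mv|\<^sup>2\<close> vanishes at its minimum point \<open>u\<close>, so its gradient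
  vanishes there, which is the eigenvalue equation \<open>M\<^sup>*Mu = s\<^sup>2u\<close>.\<close>

lemma singular_values_nonempty:
  fixes M :: "complex^'m^'n"
  shows "singular_values M \<noteq> {}"
proof -
  let ?H = "conj_transpose M ** M"
  have HM: "x \<bullet> (?H *v y) = (M *v x) \<bullet> (M *v y)" for x y
    by (metis inner_conj_transpose inner_commute matrix_vector_mul_assoc)
  have lin: "linear ((*v) M)"
    by (simp add: linear_iff matrix_vector_right_distrib)
       (simp add: vec_eq_iff matrix_vector_mult_def scaleR_sum_right)
  have "compact (sphere (0::complex^'m) 1)" by simp
  moreover have "sphere (0::complex^'m) 1 \<noteq> {}" by simp
  moreover have "continuous_on (sphere 0 1) (\<lambda>v. norm (M *v v))"
    by (intro continuous_intros linear_continuous_on linear_conv_bounded_linear[THEN iffD1] lin)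
  ultimately obtain u where u: "u \<in> sphere 0 1"
    and max: "\<And>v. v \<in> sphere 0 1 \<Longrightarrow> norm (M *v v) \<le> norm (M *v u)"
    using continuous_attains_sup[of "sphere 0 1" "\<lambda>v. norm (M *v v)"] by blast
  define s where "s = norm (M *v u)"
  have bound: "norm (M *v v) \<le> s * norm v" for v
  proof (cases "v = 0")
    case False
    have "norm (M *v v) = norm v * norm (M *v sgn v)"
      using False by (simp add: sgn_div_norm linear_scale[OF lin])
    also have "\<dots> \<le> norm v * s"
      unfolding s_def using max[of "sgn v"] False by (intro mult_left_mono) (auto simp: norm_sgn)
    finally show ?thesis by (simp add: mult.commute)
  qed (simp add: linear_0[OF lin])
  have bound_sq: "(M *v v) \<bullet> (M *v v) \<le> s\<^sup>2 * (v \<bullet> v)" for v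
    using power_mono[OF bound[of v], of 2]
    by (simp add: power_mult_distrib power2_norm_eq_inner)
  have uu: "u \<bullet> u = 1" "(M *v u) \<bullet> (M *v u) = s\<^sup>2"
    using u by (simp_all add: s_def dot_square_norm)
  \<comment> \<open>The residual \<open>r\<close> is, up to a positive factor, the negative gradient of the
    form \<open>s\<^sup>2|v|\<^sup>2 - |Mv|\<^sup>2\<close> at \<open>u\<close>. The form cannot become negative along \<open>u + t r\<close>,
    which forces \<open>r = 0\<close>.\<close>
  define r where "r = ?H *v u - s\<^sup>2 *\<^sub>R u"
  define c where "c = s\<^sup>2 * (r \<bullet> r) - (M *v r) \<bullet> (M *v r)"
  have rr: "r \<bullet> r = (M *v r) \<bullet> (M *v u) - s\<^sup>2 * (r \<bullet> u)"
    using HM[of r u] by (simp add: r_def inner_diff_right)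
  have quad: "2 * t * (r \<bullet> r) \<le> t\<^sup>2 * c" for t
  proof -
    have Mru: "(M *v r) \<bullet> (M *v u) = r \<bullet> r + s\<^sup>2 * (r \<bullet> u)" using rr by simp
    have "(u + t *\<^sub>R r) \<bullet> (u + t *\<^sub>R r) = 1 + 2 * t * (r \<bullet> u) + t\<^sup>2 * (r \<bullet> r)"
      by (simp add: uu inner_add_left inner_add_right inner_commute[of u r] power2_eq_square
          distrib_left)
    moreover have "(M *v (u + t *\<^sub>R r)) \<bullet> (M *v (u + t *\<^sub>R r))
        = s\<^sup>2 + 2 * t * ((M *v r) \<bullet> (M *v u)) + t\<^sup>2 * ((M *v r) \<bullet> (M *v r))"
      by (simp add: uu linear_add[OF lin] linear_scale[OF lin] inner_add_left inner_add_right
          inner_commute[of "M *v u" "M *v r"] power2_eq_square[of t] distrib_left)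
    ultimately have "s\<^sup>2 + 2 * t * (r \<bullet> r + s\<^sup>2 * (r \<bullet> u)) + t\<^sup>2 * ((M *v r) \<bullet> (M *v r))
        \<le> s\<^sup>2 * (1 + 2 * t * (r \<bullet> u) + t\<^sup>2 * (r \<bullet> r))"
      using bound_sq[of "u + t *\<^sub>R r"] by (simp only: Mru)
    then show ?thesis unfolding c_def by (simp add: algebra_simps)
  qed
  have "r \<bullet> r \<le> 0"
  proof (rule ccontr)
    assume "\<not> r \<bullet> r \<le> 0"
    define q where "q = r \<bullet> r"
    have q: "q > 0" using \<open>\<not> r \<bullet> r \<le> 0\<close> unfolding q_def by linarith
    have c: "c > 0" using quad[of 1, folded q_def] q by simp
    \<comment> \<open>The value \<open>t = q / c\<close> minimises \<open>t\<^sup>2 c - 2 t q\<close>.\<close>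
    have "2 * (q / c) * q \<le> (q / c)\<^sup>2 * c" using quad[of "q / c", folded q_def] .
    then show False using q c by (simp add: power2_eq_square field_simps)
  qed
  then have "r = 0" by (metis inner_gt_zero_iff not_less)
  then have "?H *v u = complex_of_real (s\<^sup>2) *s u"
    by (simp add: r_def scale_of_real del: of_real_power)
  moreover have "u \<noteq> 0" "0 \<le> s" using u by (auto simp: s_def)
  ultimately have "s \<in> singular_values M"
    by (auto simp: singular_values_def eigenvalues_def)
  then show ?thesis by blast
qed

text \<open>A right singular vector \<open>w\<close> for the singular value \<open>s\<close> satisfies \<open>|Mw| = s|w|\<close>. The pair
  \<open>(s w, M w)\<close> has components of equal norm, and for it the hypothesis reads
  \<open>2 s |Mw|\<^sup>2 \<le> 2 c |Mw|\<^sup>2\<close>, that is \<open>s \<le> c\<close> if \<open>Mw \<noteq> 0\<close>.\<close>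

lemma max_singular_value_le:
  fixes M :: "complex^'m^'n"
  assumes bound: "\<And>w z. 2 * (z \<bullet> (M *v w)) \<le> c * (w \<bullet> w + z \<bullet> z)"
  shows "max_singular_value M \<le> c"
proof -
  define s where "s = max_singular_value M"
  have "s \<in> singular_values M"
    unfolding s_def max_singular_value_def
    by (intro Max_in finite_singular_values singular_values_nonempty)
  then obtain w where w: "w \<noteq> 0"
    and eig: "conj_transpose M *v (M *v w) = complex_of_real (s\<^sup>2) *s w"
    by (auto simp: singular_values_def eigenvalues_def matrix_vector_mul_assoc)
  have gain: "(M *v w) \<bullet> (M *v w) = s\<^sup>2 * (w \<bullet> w)"
    using inner_conj_transpose[of M "M *v w" w] by (simp add: eig scale_of_real del: of_real_power)
  have ww: "0 < w \<bullet> w" using w by simp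
  show ?thesis unfolding s_def[symmetric]
  proof (cases "s = 0")
    case True
    \<comment> \<open>The pair \<open>(s w, M w)\<close> degenerates to zero; \<open>z = 0\<close> shows \<open>0 \<le> c\<close>.\<close>
    then show "s \<le> c" using bound[of 0 w] ww by (simp add: zero_le_mult_iff)
  next
    case False
    have "M *v (s *\<^sub>R w) = s *\<^sub>R (M *v w)"
      by (simp add: vec_eq_iff matrix_vector_mult_def scaleR_sum_right)
    with bound[of "M *v w" "s *\<^sub>R w"]
    have "s * (2 * s\<^sup>2 * (w \<bullet> w)) \<le> c * (2 * s\<^sup>2 * (w \<bullet> w))"
      by (simp add: gain power2_eq_square algebra_simps)
    then show "s \<le> c" using False ww by (simp add: mult_le_cancel_right)
  qed
qed

section \<open>Stability and gain bound\<close>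

theorem theorem1:
  fixes A\<^sub>c\<^sub>l :: "real^'n^'n" and B\<^sub>c\<^sub>l :: "real^'w^'n"
    and C\<^sub>c\<^sub>l :: "real^'n^'z" and D\<^sub>c\<^sub>l :: "real^'w^'z"
    and \<gamma>\<^sub>n\<^sub>e\<^sub>w :: real
  assumes "\<exists>(\<epsilon>\<^sub>1::real) (X\<^sub>1::real^'n^'n) (G\<^sub>1::real^'n^'n).
      0 < \<epsilon>\<^sub>1 \<and> \<epsilon>\<^sub>1 < 1 \<and> pos_def_matrix X\<^sub>1 \<and>
      neg_def_matrix (lmi_base \<gamma>\<^sub>n\<^sub>e\<^sub>w B\<^sub>c\<^sub>l D\<^sub>c\<^sub>l X\<^sub>1
        + He (transpose (lmi_Q A\<^sub>c\<^sub>l C\<^sub>c\<^sub>l) ** G\<^sub>1 ** lmi_P \<epsilon>\<^sub>1))"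
  shows "hurwitz A\<^sub>c\<^sub>l \<and> L2_gain A\<^sub>c\<^sub>l B\<^sub>c\<^sub>l C\<^sub>c\<^sub>l D\<^sub>c\<^sub>l < ereal \<gamma>\<^sub>n\<^sub>e\<^sub>w"
proof -
  obtain \<epsilon> X and G :: "real^'n^'n" where X: "pos_def_matrix X"
    and lmi: "neg_def_matrix (lmi_base \<gamma>\<^sub>n\<^sub>e\<^sub>w B\<^sub>c\<^sub>l D\<^sub>c\<^sub>l X
        + He (transpose (lmi_Q A\<^sub>c\<^sub>l C\<^sub>c\<^sub>l) ** G ** lmi_P \<epsilon>))"
    using assms by blast
  have symX: "transpose X = X" using X by (simp add: pos_def_matrix_def)
  obtain \<delta> where \<delta>: "\<delta> > 0"
    and real_ineq: "\<And>x w z. 2 * (x \<bullet> (X *v (transpose A\<^sub>c\<^sub>l *v x + transpose C\<^sub>c\<^sub>l *v z)))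
        + 2 * (x \<bullet> (B\<^sub>c\<^sub>l *v w)) + 2 * (z \<bullet> (D\<^sub>c\<^sub>l *v w)) - \<gamma>\<^sub>n\<^sub>e\<^sub>w * (w \<bullet> w) - \<gamma>\<^sub>n\<^sub>e\<^sub>w * (z \<bullet> z)
      \<le> - \<delta> * (x \<bullet> x + w \<bullet> w + z \<bullet> z)"
    using lmi_dual_bounded_real[OF symX lmi] by blast
  \<comment> \<open>The sum of the real inequality over real and imaginary parts.\<close>
  have ineq: "2 * (x \<bullet> (cmat X *v (cmat (transpose A\<^sub>c\<^sub>l) *v x + cmat (transpose C\<^sub>c\<^sub>l) *v z)))
        + 2 * (x \<bullet> (cmat B\<^sub>c\<^sub>l *v w)) + 2 * (z \<bullet> (cmat D\<^sub>c\<^sub>l *v w))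
        - \<gamma>\<^sub>n\<^sub>e\<^sub>w * (w \<bullet> w) - \<gamma>\<^sub>n\<^sub>e\<^sub>w * (z \<bullet> z)
      \<le> - \<delta> * (x \<bullet> x + w \<bullet> w + z \<bullet> z)" for x w z
    using real_ineq[of "Re_vec x" "Re_vec z" "Re_vec w"] real_ineq[of "Im_vec x" "Im_vec z" "Im_vec w"]
    by (simp add: inner_Re_Im Re_vec_cmat Im_vec_cmat Re_vec_add Im_vec_add algebra_simps)
  have hur: "hurwitz A\<^sub>c\<^sub>l"
    unfolding hurwitz_def
  proof
    fix l assume "l \<in> eigenvalues (cmat A\<^sub>c\<^sub>l)"
    moreover have "cmat (transpose A\<^sub>c\<^sub>l) = transpose (cmat A\<^sub>c\<^sub>l)"
      by (simp add: vec_eq_iff cmat_def map_matrix_def transpose_def)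
    ultimately have "l \<in> eigenvalues (cmat (transpose A\<^sub>c\<^sub>l))"
      by (simp add: eigenvalues_transpose)
    then obtain x where x: "x \<noteq> 0" "cmat (transpose A\<^sub>c\<^sub>l) *v x = l *s x"
      by (auto simp: eigenvalues_def)
    have "2 * (Re l * (x \<bullet> (cmat X *v x))) \<le> - \<delta> * (x \<bullet> x)"
      using ineq[of x 0 0] x(2) by (simp add: inner_cmat_scale[OF symX])
    also have "\<dots> < 0" using \<delta> x(1) by simp
    finally show "Re l < 0"
      using inner_cmat_pos[OF X x(1)] by (simp add: mult_less_0_iff)
  qed
  have "max_singular_value (transfer_function A\<^sub>c\<^sub>l B\<^sub>c\<^sub>l C\<^sub>c\<^sub>l D\<^sub>c\<^sub>l (\<i> * complex_of_real \<omega>)) \<le> \<gamma>\<^sub>n\<^sub>e\<^sub>w - \<delta>" for \<omega>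
  proof (rule max_singular_value_le)
    fix w :: "complex^'w" and z :: "complex^'z"
    define s where "s = \<i> * complex_of_real \<omega>"
    define S where "S = mat s - cmat A\<^sub>c\<^sub>l"
    \<comment> \<open>The response of the dual system to \<open>z\<close>, which turns \<open>x\<^sup>*Bw\<close> into \<open>z\<^sup>*C(sI - A)\<^sup>-\<^sup>1Bw\<close>.\<close>
    define x where "x = conj_transpose (matrix_inv S) *v (cmat (transpose C\<^sub>c\<^sub>l) *v z)"
    have "s \<notin> eigenvalues (cmat A\<^sub>c\<^sub>l)"
      using hur by (auto simp: hurwitz_def s_def)
    then have "invertible S"
      by (simp add: S_def invertible_iff_not_eigenvalue)
    then have "matrix_inv S ** S = mat 1"
      unfolding invertible_def matrix_inv_def by (rule someI2_ex) simp
    then have "conj_transpose S ** conj_transpose (matrix_inv S) = conj_transpose (mat 1)"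
      by (metis conj_transpose_mult)
    also have "conj_transpose (mat 1) = (mat 1 :: complex^'n^'n)"
      by (simp add: vec_eq_iff conj_transpose_def map_matrix_def transpose_def mat_def)
    finally have "conj_transpose S *v x = cmat (transpose C\<^sub>c\<^sub>l) *v z"
      by (simp add: x_def matrix_vector_mul_assoc matrix_mul_assoc)
    then have adj: "cmat (transpose A\<^sub>c\<^sub>l) *v x + cmat (transpose C\<^sub>c\<^sub>l) *v z = cnj s *s x"
      by (simp add: S_def conj_transpose_char_matrix matrix_vector_mult_diff_rdistrib mat_mult_vec algebra_simps)
    have "Re (cnj s) = 0" by (simp add: s_def)
    then have storage: "x \<bullet> (cmat X *v (cmat (transpose A\<^sub>c\<^sub>l) *v x + cmat (transpose C\<^sub>c\<^sub>l) *v z)) = 0"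
      unfolding adj by (simp add: inner_cmat_scale[OF symX])
    have "x \<bullet> (cmat B\<^sub>c\<^sub>l *v w) = z \<bullet> (cmat C\<^sub>c\<^sub>l *v (matrix_inv S *v (cmat B\<^sub>c\<^sub>l *v w)))"
      by (simp add: x_def inner_conj_transpose flip: conj_transpose_cmat)
    then have "z \<bullet> (transfer_function A\<^sub>c\<^sub>l B\<^sub>c\<^sub>l C\<^sub>c\<^sub>l D\<^sub>c\<^sub>l s *v w)
        = x \<bullet> (cmat B\<^sub>c\<^sub>l *v w) + z \<bullet> (cmat D\<^sub>c\<^sub>l *v w)"
      by (simp add: transfer_function_def S_def matrix_vector_mult_add_rdistrib inner_add_right
          matrix_vector_mul_assoc[symmetric])
    moreover have "0 \<le> \<delta> * (x \<bullet> x)" using \<delta> by simp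
    ultimately show "2 * (z \<bullet> (transfer_function A\<^sub>c\<^sub>l B\<^sub>c\<^sub>l C\<^sub>c\<^sub>l D\<^sub>c\<^sub>l (\<i> * complex_of_real \<omega>) *v w))
        \<le> (\<gamma>\<^sub>n\<^sub>e\<^sub>w - \<delta>) * (w \<bullet> w + z \<bullet> z)"
      using ineq[of x z w] storage by (simp add: s_def algebra_simps)
  qed
  then have "L2_gain A\<^sub>c\<^sub>l B\<^sub>c\<^sub>l C\<^sub>c\<^sub>l D\<^sub>c\<^sub>l \<le> ereal (\<gamma>\<^sub>n\<^sub>e\<^sub>w - \<delta>)"
    unfolding L2_gain_def by (intro SUP_least) simp
  also have "\<dots> < ereal \<gamma>\<^sub>n\<^sub>e\<^sub>w" using \<delta> by simp
  finally show ?thesis using hur by blast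
qed

end
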